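(* Let $\lambda>0$. Let $U,W:\mathbf{V}\to\mathbb{R}$ be a subsolution and a supersolution, respectively, of the discrete equation, i.e. $$U(x)\le\min_{e\in\mathbf{E},\ \mathrm{t}(e)=x}\rho\big(U(\mathrm{o}(e)),e\big),\qquad W(x)\ge\min_{e\in\mathbf{E},\ \mathrm{t}(e)=x}\rho\big(W(\mathrm{o}(e)),e\big)\qquad\text{for all }x\in\mathbf{V}.$$ Then $U\le W$ on $\mathbf{V}$.
   Context: Network: $\Gamma=\bigcup_{\gamma\in\mathcal{E}}\gamma([0,1])\subset\mathbb{R}^N$, where $\mathcal{E}$ is a finite collection of regular simple curves $\gamma:[0,1]\to\mathbb{R}^N$ (arcs; closed arcs with $\gamma(0)=\gamma(1)$, and several arcs joining the same points, are allowed). For each arc $\gamma$ the inverse arc $-\gamma$, $(-\gamma)(s)=\gamma(1-s)$, also belongs to $\mathcal{E}$ and is regarded as distinct from $\gamma$; and $\gamma((0,1))\cap\gamma'([0,1])=\emptyset$ whenever $\gamma\ne\pm\gamma'$. $\mathbf{V}$ is the (finite) set of vertices, i.e. of initial and terminal points of arcs. $\Gamma$ is connected: any two vertices are linked by a finite concatenation of arcs. Hamiltonians: for each $\gamma\in\mathcal{E}$, $H_\gamma:[0,1]\times\mathbb{R}\to\mathbb{R}$ is continuous in $(s,p)$, coercive in $p$ ($H_\gamma(s,p)\to+\infty$ as $|p|\to\infty$, uniformly in $s$), and $H_{-\gamma}(s,p)=H_\gamma(1-s,-p)$. No convexity is assumed. Equation on an arc: (E$_\gamma$) $\lambda w+H_\gamma(s,w')=0$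 in $(0,1)$; subsolutions are continuous functions on $[0,1]$ that are viscosity subsolutions in $(0,1)$. Graph: $\mathbf{E}$ is an abstract set with a bijection $\Psi:\mathbf{E}\to\mathcal{E}$; for $e\in\mathbf{E}$ put $\mathrm{o}(e)=\Psi(e)(0)$, $-e=\Psi^{-1}(-\Psi(e))$, $\mathrm{t}(e)=\mathrm{o}(-e)=\Psi(e)(1)$. For $\alpha\in\mathbb{R}$ and $\gamma\in\mathcal{E}$ let $u_\alpha^\gamma(s)=\sup\{w(s): w$ subsolution of (E$_\gamma$) with $w(0)\le\alpha\}$, $s\in[0,1]$, and set $\rho(\alpha,e)=u_\alpha^{\Psi(e)}(1)$. *)

theory Defs
  imports "HOL-Analysis.Analysis"
begin

section \<open>Networks\<close>

text \<open>
  Curves are total functions on the reals, of which only the restriction to the unit interval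
  matters. The derivative is one-sided at the end points, so the values of the curve outside the
  unit interval play no role (unlike for \<^const>\<open>C1_differentiable_on\<close>), and the
  two one-sided derivatives of a closed arc at its end points are unrelated.
\<close>

definition regular_curve :: "(real \<Rightarrow> 'a::real_normed_vector) \<Rightarrow> bool" where
  "regular_curve \<gamma> \<longleftrightarrow>
     (\<exists>\<gamma>'. continuous_on {0..1} \<gamma>' \<and>
       (\<forall>s\<in>{0..1}. (\<gamma> has_vector_derivative \<gamma>' s) (at s within {0..1}) \<and> \<gamma>' s \<noteq> 0))"

definition vertices :: "(real \<Rightarrow> 'a::real_normed_vector) set \<Rightarrow> 'a set" where
  "vertices \<A> = pathstart ` \<A> \<union> pathfinish ` \<A>"

text \<open>
  The inverse of an arc is its \<^const>\<open>reversepath\<close>. The notion \<^const>\<open>simple_path\<close>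
  allows the two end points to coincide, and it implies that an arc differs from its inverse.
  Two distinct members of \<open>\<A>\<close> cannot agree on the unit interval: this is excluded by
  simplicity if they are inverse to each other, and by the disjointness condition otherwise.
\<close>

definition network :: "(real \<Rightarrow> 'a::real_normed_vector) set \<Rightarrow> bool" where
  "network \<A> \<longleftrightarrow>
     finite \<A> \<and>
     (\<forall>\<gamma>\<in>\<A>. simple_path \<gamma> \<and> regular_curve \<gamma>) \<and>
     (\<forall>\<gamma>\<in>\<A>. reversepath \<gamma> \<in> \<A>) \<and>
     (\<forall>\<gamma>\<in>\<A>. \<forall>\<gamma>'\<in>\<A>. \<gamma> \<noteq> \<gamma>' \<and> \<gamma> \<noteq> reversepath \<gamma>' \<longrightarrow>
        \<gamma> ` {0<..<1} \<inter> \<gamma>' ` {0..1} = {}) \<and>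
     (\<forall>x\<in>vertices \<A>. \<forall>y\<in>vertices \<A>.
        (x, y) \<in> {(pathstart \<gamma>, pathfinish \<gamma>) | \<gamma>. \<gamma> \<in> \<A>}\<^sup>+)"

definition hamiltonians ::
  "(real \<Rightarrow> 'a::real_normed_vector) set \<Rightarrow> ((real \<Rightarrow> 'a) \<Rightarrow> real \<Rightarrow> real \<Rightarrow> real) \<Rightarrow> bool" where
  "hamiltonians \<A> H \<longleftrightarrow>
     (\<forall>\<gamma>\<in>\<A>.
        continuous_on ({0..1} \<times> UNIV) (\<lambda>(s, p). H \<gamma> s p) \<and>
        (\<forall>M. \<exists>R. \<forall>s\<in>{0..1}. \<forall>p. \<bar>p\<bar> \<ge> R \<longrightarrow> H \<gamma> s p \<ge> M) \<and>
        (\<forall>s\<in>{0..1}. \<forall>p. H (reversepath \<gamma>) s p = H \<gamma> (1 - s) (- p)))"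

section \<open>The equation on an arc\<close>

text \<open>
  Continuous viscosity subsolutions of \<open>c w + h(s, w') = 0\<close> in the open unit interval: the
  inequality is tested with every \<open>C\<^sup>1\<close> function \<open>\<phi>\<close> (with derivative \<open>\<phi>'\<close>) touching
  \<open>w\<close> locally from above up to a constant. No condition is imposed at \<open>0\<close> and \<open>1\<close>.
\<close>

definition viscosity_subsolution ::
  "real \<Rightarrow> (real \<Rightarrow> real \<Rightarrow> real) \<Rightarrow> (real \<Rightarrow> real) \<Rightarrow> bool" where
  "viscosity_subsolution c h w \<longleftrightarrow>
     continuous_on {0..1} w \<and>
     (\<forall>s\<in>{0<..<1}. \<forall>\<phi> \<phi>'.
        (\<forall>t\<in>{0<..<1}. (\<phi> has_real_derivative \<phi>' t) (at t)) \<longrightarrow>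
        continuous_on {0<..<1} \<phi>' \<longrightarrow>
        (\<forall>\<^sub>F t in nhds s. w t - \<phi> t \<le> w s - \<phi> s) \<longrightarrow>
        c * w s + h s (\<phi>' s) \<le> 0)"

text \<open>
  For positive \<open>c\<close> and continuous coercive \<open>h\<close> the set below is nonempty (it contains the
  values of sufficiently negative constants) and bounded above (a subsolution is at most
  \<open>- min h / c\<close>), so that the real supremum is the genuine one.
\<close>

definition max_subsolution ::
  "real \<Rightarrow> (real \<Rightarrow> real \<Rightarrow> real) \<Rightarrow> real \<Rightarrow> real \<Rightarrow> real" where
  "max_subsolution c h \<alpha> s = Sup {w s | w. viscosity_subsolution c h w \<and> w 0 \<le> \<alpha>}"

section \<open>The abstract graph and the discrete equation\<close>

definition edge_orig :: "('e \<Rightarrow> real \<Rightarrow> 'a::real_normed_vector) \<Rightarrow> 'e \<Rightarrow> 'a" where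
  "edge_orig \<Psi> e = pathstart (\<Psi> e)"

definition edge_rev :: "'e set \<Rightarrow> ('e \<Rightarrow> real \<Rightarrow> 'a::real_normed_vector) \<Rightarrow> 'e \<Rightarrow> 'e" where
  "edge_rev Es \<Psi> e = inv_into Es \<Psi> (reversepath (\<Psi> e))"

definition edge_term :: "'e set \<Rightarrow> ('e \<Rightarrow> real \<Rightarrow> 'a::real_normed_vector) \<Rightarrow> 'e \<Rightarrow> 'a" where
  "edge_term Es \<Psi> e = edge_orig \<Psi> (edge_rev Es \<Psi> e)"

definition edge_rho ::
  "real \<Rightarrow> ((real \<Rightarrow> 'a) \<Rightarrow> real \<Rightarrow> real \<Rightarrow> real) \<Rightarrow> ('e \<Rightarrow> real \<Rightarrow> 'a) \<Rightarrow> real \<Rightarrow> 'e \<Rightarrow> real" where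
  "edge_rho c H \<Psi> \<alpha> e = max_subsolution c (H (\<Psi> e)) \<alpha> 1"

text \<open>
  The edge sets over which the minimum is taken are finite, and nonempty at every vertex since
  arcs come with their inverses.
\<close>

definition discrete_rhs ::
  "real \<Rightarrow> ((real \<Rightarrow> 'a::real_normed_vector) \<Rightarrow> real \<Rightarrow> real \<Rightarrow> real) \<Rightarrow> 'e set \<Rightarrow>
     ('e \<Rightarrow> real \<Rightarrow> 'a) \<Rightarrow> ('a \<Rightarrow> real) \<Rightarrow> 'a \<Rightarrow> real" where
  "discrete_rhs c H Es \<Psi> U x =
     Min {edge_rho c H \<Psi> (U (edge_orig \<Psi> e)) e | e. e \<in> Es \<and> edge_term Es \<Psi> e = x}"

end

theory Submission
  imports Defs
begin

text \<open>
  The proof evaluates \<open>U - W\<close> at a vertex \<open>x\<close> where it is maximal. Suppose that the maximum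
  \<open>\<delta>\<close> is positive, and let \<open>e\<close> be an edge ending at \<open>x\<close> that realizes the minimum in the
  inequality for \<open>W\<close>. Then \<open>\<delta> = U x - W x\<close> is at most \<open>\<rho>(\<alpha>, e) - \<rho>(\<beta>, e)\<close>, where
  \<open>\<alpha>\<close> and \<open>\<beta>\<close> are the values of \<open>U\<close> and \<open>W\<close> at the origin of \<open>e\<close>, and
  \<open>\<alpha> \<le> \<beta> + \<delta>\<close> by maximality. This contradicts the strict estimate
  \<open>\<rho>(\<alpha>, e) < \<rho>(\<beta>, e) + \<delta>\<close> (lemma \<open>max_subsolution_strict\<close>).

  The strict estimate comes from the zeroth-order term. If \<open>w\<close> is a subsolution, then
  \<open>w - \<delta>\<close> satisfies the inequality with the margin \<open>c * \<delta>\<close>. Part of this margin can be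
  spent on tilting: \<open>w - \<delta> + \<epsilon> s\<close> is still a subsolution for small \<open>\<epsilon>\<close>; it is
  unchanged at \<open>0\<close> and gains \<open>\<epsilon>\<close> at \<open>1\<close>. To survive in the supremum that defines
  \<open>\<rho>\<close>, the gain \<open>\<epsilon>\<close> must not depend on \<open>w\<close>. By coercivity, a common lower bound on the
  functions \<open>w\<close> confines their slopes to one compact interval, on which the Hamiltonian is
  uniformly continuous, and such a bound is obtained by replacing \<open>w\<close> with its maximum with a
  very negative constant (lemma \<open>viscosity_subsolution_max_const\<close>).
\<close>

section \<open>Coercive Hamiltonians\<close>

lemma coercive_bounded_below:
  fixes h :: "real \<Rightarrow> real \<Rightarrow> real"
  assumes cont: "continuous_on ({0..1} \<times> UNIV) (\<lambda>(s, p). h s p)"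
    and coer: "\<forall>M. \<exists>R. \<forall>s\<in>{0..1}. \<forall>p. \<bar>p\<bar> \<ge> R \<longrightarrow> h s p \<ge> M"
  shows "\<exists>m. \<forall>s\<in>{0..1}. \<forall>p. m \<le> h s p"
proof -
  obtain R where R: "\<forall>s\<in>{0..1}. \<forall>p. \<bar>p\<bar> \<ge> R \<longrightarrow> h s p \<ge> 0"
    using coer by blast
  have "compact ((\<lambda>(s, p). h s p) ` ({0..1} \<times> {-R..R}))"
    by (intro compact_continuous_image continuous_on_subset[OF cont] compact_Times) auto
  then have "bdd_below ((\<lambda>(s, p). h s p) ` ({0..1} \<times> {-R..R}))"
    by (intro bounded_imp_bdd_below compact_imp_bounded)
  then obtain m where m: "\<And>s p. s \<in> {0..1} \<Longrightarrow> p \<in> {-R..R} \<Longrightarrow> m \<le> h s p"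
    unfolding bdd_below_def by force
  have "min m 0 \<le> h s p" if "s \<in> {0..1}" for s p
  proof (cases "\<bar>p\<bar> \<ge> R")
    case True
    then show ?thesis using R that by fastforce
  next
    case False
    then have "p \<in> {-R..R}" by (auto simp: abs_le_iff not_le)
    then show ?thesis using m[OF that] by (simp add: min.coboundedI1)
  qed
  then show ?thesis by blast
qed

text \<open>
  The shift \<open>\<epsilon>\<close> in the slope is uniform over the sublevel set \<open>h \<le> M\<close>, because coercivity
  makes this set bounded.
\<close>

lemma coercive_slope_shift:
  fixes h :: "real \<Rightarrow> real \<Rightarrow> real"
  assumes cont: "continuous_on ({0..1} \<times> UNIV) (\<lambda>(s, p). h s p)"
    and coer: "\<forall>M. \<exists>R. \<forall>s\<in>{0..1}. \<forall>p. \<bar>p\<bar> \<ge> R \<longrightarrow> h s p \<ge> M"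
    and "\<eta> > 0"
  shows "\<exists>d>0. \<forall>\<epsilon>\<in>{0..<d}. \<forall>s\<in>{0..1}. \<forall>p. h s p \<le> M \<longrightarrow> h s (p + \<epsilon>) \<le> h s p + \<eta>"
proof -
  obtain R where R: "\<forall>s\<in>{0..1}. \<forall>p. \<bar>p\<bar> \<ge> R \<longrightarrow> h s p \<ge> M + 1"
    using coer by blast
  let ?K = "{0..1} \<times> {-R-1..R+1}"
  have "continuous_on ?K (\<lambda>(s, p). h s p)"
    by (rule continuous_on_subset[OF cont]) auto
  then have "uniformly_continuous_on ?K (\<lambda>(s, p). h s p)"
    by (rule compact_uniformly_continuous) (simp add: compact_Times)
  from this[unfolded uniformly_continuous_on_def, THEN spec, THEN mp, OF \<open>\<eta> > 0\<close>]
  obtain d where d: "d > 0"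
    and dK: "\<forall>z\<in>?K. \<forall>z'\<in>?K. dist z' z < d \<longrightarrow>
      dist (case z' of (s, p) \<Rightarrow> h s p) (case z of (s, p) \<Rightarrow> h s p) < \<eta>"
    by (elim exE conjE)
  have "h s (p + \<epsilon>) \<le> h s p + \<eta>"
    if "\<epsilon> \<in> {0..<min d 1}" "s \<in> {0..1}" "h s p \<le> M" for \<epsilon> s p
  proof -
    have "\<not> R \<le> \<bar>p\<bar>" using R[rule_format, of s p] that(2,3) by auto
    then have "\<bar>p\<bar> < R" by simp
    then have "dist (h s (p + \<epsilon>)) (h s p) < \<eta>"
      using dK[rule_format, of "(s, p)" "(s, p + \<epsilon>)"] that by (auto simp: dist_Pair_Pair dist_real_def)
    then show ?thesis by (auto simp: dist_real_def)
  qed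
  then show ?thesis using d by (intro exI[of _ "min d 1"] conjI ballI allI impI) (simp, blast)
qed

section \<open>Viscosity subsolutions\<close>

lemma viscosity_subsolution_test:
  assumes "viscosity_subsolution c h w" "s \<in> {0<..<1}"
    and "\<forall>t\<in>{0<..<1}. (\<phi> has_real_derivative \<phi>' t) (at t)"
    and "continuous_on {0<..<1} \<phi>'"
    and "\<forall>\<^sub>F t in nhds s. w t - \<phi> t \<le> w s - \<phi> s"
  shows "c * w s + h s (\<phi>' s) \<le> 0"
  using assms(1)[unfolded viscosity_subsolution_def, THEN conjunct2, THEN bspec, OF assms(2),
      THEN spec[of _ \<phi>], THEN spec[of _ \<phi>']] assms(3-5) by (elim impE)

text \<open>
  A continuous function is touched from above by steep parabolas near every point, in particular
  near \<open>1\<close>, where the inequality itself is not imposed. At a point of contact the subsolution is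
  at most \<open>- m / c\<close>, and continuity carries this bound to the end point.
\<close>

lemma viscosity_subsolution_bound:
  fixes h :: "real \<Rightarrow> real \<Rightarrow> real"
  assumes sub: "viscosity_subsolution c h w"
    and "c > 0"
    and m: "\<forall>s\<in>{0..1}. \<forall>p. m \<le> h s p"
  shows "w 1 \<le> - m / c"
proof (rule ccontr)
  assume "\<not> w 1 \<le> - m / c"
  then have gt: "- m / c < w 1" by simp
  have cw: "continuous_on {0..1} w"
    using sub unfolding viscosity_subsolution_def by blast
  have "0 < w 1 + m / c" using gt by simp
  then obtain d where d: "d > 0"
    and dw: "\<And>t. t \<in> {0..1} \<Longrightarrow> dist t 1 < d \<Longrightarrow> dist (w t) (w 1) < w 1 + m / c"
    using cw[unfolded continuous_on_iff, THEN bspec, of 1] by auto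
  define a where "a = max (1 / 2) (1 - d / 2)"
  have a: "0 < a" "a < 1" "1 - a < d" using d by (auto simp: a_def)
  define b where "b = (a + 1) / 2"
  have b: "a < b" "b < 1" using a by (auto simp: b_def)
  have "bounded (w ` {0..1})"
    by (intro compact_imp_bounded compact_continuous_image cw) auto
  then obtain B where B: "\<And>t. t \<in> {0..1} \<Longrightarrow> \<bar>w t\<bar> \<le> B"
    unfolding bounded_iff by (metis image_eqI real_norm_def)
  \<comment> \<open>The factor is chosen such that at \<open>a\<close> and \<open>1\<close>, both at distance \<open>b - a\<close> from
    the vertex \<open>b\<close> of the parabola, the parabola exceeds the oscillation \<open>2 * B\<close> of \<open>w\<close>.\<close>
  define k where "k = (2 * B + 1) / (b - a)^2"
  define \<phi> where "\<phi> t = k * (t - b)^2" for t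
  have "continuous_on {a..1} (\<lambda>t. w t - \<phi> t)"
    unfolding \<phi>_def using a by (intro continuous_intros continuous_on_subset[OF cw]) auto
  then obtain s where s: "s \<in> {a..1}" and smax: "\<And>t. t \<in> {a..1} \<Longrightarrow> w t - \<phi> t \<le> w s - \<phi> s"
    using continuous_attains_sup[of "{a..1}" "\<lambda>t. w t - \<phi> t"] a by auto
  have "b - a \<noteq> 0" using b by simp
  then have pa: "\<phi> a = 2 * B + 1" unfolding \<phi>_def k_def
    by (simp add: power2_commute)
  have "1 - b = b - a" by (simp add: b_def field_simps)
  then have "\<phi> 1 = k * (b - a)^2" by (simp only: \<phi>_def)
  then have p1: "\<phi> 1 = 2 * B + 1" unfolding k_def using \<open>b - a \<noteq> 0\<close> by simp
  have pb: "\<phi> b = 0" by (simp add: \<phi>_def)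
  have sb: "w b \<le> w s - \<phi> s" using smax[of b] b pb by auto
  have "\<bar>w b\<bar> \<le> B" "\<bar>w s\<bar> \<le> B" using B a b s by auto
  then have "s \<noteq> a" "s \<noteq> 1" using sb pa p1 by auto
  then have s': "s \<in> {a<..<1}" using s by auto
  have "\<forall>\<^sub>F t in nhds s. t \<in> {a<..<1}"
    using s' by (intro eventually_nhds_in_open) auto
  then have ev: "\<forall>\<^sub>F t in nhds s. w t - \<phi> t \<le> w s - \<phi> s"
    by eventually_elim (use smax in auto)
  have der: "\<forall>t\<in>{0<..<1}. (\<phi> has_real_derivative k * (2 * (t - b))) (at t)"
    unfolding \<phi>_def by (auto intro!: derivative_eq_intros)
  have "continuous_on {0<..<1} (\<lambda>t. k * (2 * (t - b)))"
    by (intro continuous_intros)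
  moreover have "s \<in> {0<..<1}" using s' a by auto
  ultimately have "c * w s + h s (k * (2 * (s - b))) \<le> 0"
    using viscosity_subsolution_test[OF sub _ der _ ev] by blast
  moreover have "m \<le> h s (k * (2 * (s - b)))" using m s' a by auto
  ultimately have "w s * c \<le> - m" by (simp add: mult.commute)
  then have "w s \<le> - m / c" using \<open>c > 0\<close> by (simp only: pos_le_divide_eq)
  moreover have "dist (w s) (w 1) < w 1 + m / c"
    using dw[of s] s' a by (auto simp: dist_real_def)
  ultimately show False by (auto simp: dist_real_def)
qed

text \<open>
  Truncation from below by a constant \<open>- K\<close> preserves subsolutions. At a point where the
  maximum equals \<open>- K\<close>, the test function has a local minimum, hence slope \<open>0\<close>, and the
  hypothesis on \<open>K\<close> is the required inequality.
\<close>

lemma viscosity_subsolution_max_const: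
  fixes h :: "real \<Rightarrow> real \<Rightarrow> real"
  assumes sub: "viscosity_subsolution c h w"
    and K: "\<forall>s\<in>{0..1}. h s 0 \<le> c * K"
  shows "viscosity_subsolution c h (\<lambda>t. max (w t) (- K))"
  unfolding viscosity_subsolution_def
proof (intro conjI ballI allI impI)
  show "continuous_on {0..1} (\<lambda>t. max (w t) (- K))"
    using sub unfolding viscosity_subsolution_def by (auto intro!: continuous_intros)
next
  fix s :: real and \<phi> \<phi>' :: "real \<Rightarrow> real"
  assume s: "s \<in> {0<..<1}"
    and der: "\<forall>t\<in>{0<..<1}. (\<phi> has_real_derivative \<phi>' t) (at t)"
    and c1: "continuous_on {0<..<1} \<phi>'"
    and ev: "\<forall>\<^sub>F t in nhds s. max (w t) (- K) - \<phi> t \<le> max (w s) (- K) - \<phi> s"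
  show "c * max (w s) (- K) + h s (\<phi>' s) \<le> 0"
  proof (cases "- K \<le> w s")
    case True
    have "\<forall>\<^sub>F t in nhds s. w t - \<phi> t \<le> w s - \<phi> s"
      using ev by eventually_elim (use True in auto)
    then have "c * w s + h s (\<phi>' s) \<le> 0"
      by (rule viscosity_subsolution_test[OF sub s der c1])
    then show ?thesis using True by (simp add: max_absorb1)
  next
    case False
    have "\<forall>\<^sub>F t in nhds s. \<phi> s \<le> \<phi> t"
      using ev by eventually_elim (use False in auto)
    then obtain r where r: "r > 0" "\<And>t. dist t s < r \<Longrightarrow> \<phi> s \<le> \<phi> t"
      unfolding eventually_nhds_metric by blast
    have "\<phi>' s = 0"
      using DERIV_local_min[of \<phi> "\<phi>' s" s r] der s r by (auto simp: dist_real_def abs_minus_commute)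
    then show ?thesis using False K s by (auto simp: max_def)
  qed
qed

lemma viscosity_subsolution_const:
  fixes h :: "real \<Rightarrow> real \<Rightarrow> real"
  assumes K: "\<forall>s\<in>{0..1}. h s 0 \<le> c * K"
  shows "viscosity_subsolution c h (\<lambda>_. - K)"
  unfolding viscosity_subsolution_def
proof (intro conjI ballI allI impI)
  fix s :: real and \<phi> \<phi>' :: "real \<Rightarrow> real"
  assume s: "s \<in> {0<..<1}"
    and der: "\<forall>t\<in>{0<..<1}. (\<phi> has_real_derivative \<phi>' t) (at t)"
    and ev: "\<forall>\<^sub>F t in nhds s. - K - \<phi> t \<le> - K - \<phi> s"
  obtain r where r: "r > 0" "\<And>t. dist t s < r \<Longrightarrow> \<phi> s \<le> \<phi> t"
    using ev unfolding eventually_nhds_metric by auto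
  have "\<phi>' s = 0"
    using DERIV_local_min[of \<phi> "\<phi>' s" s r] der s r by (auto simp: dist_real_def abs_minus_commute)
  then show "c * (- K) + h s (\<phi>' s) \<le> 0" using K s by auto
qed auto

text \<open>
  Lowering by \<open>\<delta>\<close> gains \<open>c * \<delta>\<close> in the zeroth-order term. One half of it pays for the slope
  shift in \<open>h\<close>, the other half for the increase \<open>c * \<epsilon> * s\<close>. The lower bound \<open>- K\<close> on \<open>w\<close>
  is what places every admissible slope in the sublevel set \<open>h \<le> c * K\<close>.
\<close>

lemma viscosity_subsolution_tilt:
  fixes h :: "real \<Rightarrow> real \<Rightarrow> real"
  assumes sub: "viscosity_subsolution c h w"
    and "c > 0"
    and low: "\<forall>t\<in>{0..1}. - K \<le> w t"
    and shift: "\<forall>s\<in>{0..1}. \<forall>p. h s p \<le> c * K \<longrightarrow> h s (p + \<epsilon>) \<le> h s p + c * \<delta> / 2"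
    and eps: "0 \<le> \<epsilon>" "\<epsilon> \<le> \<delta> / 2"
  shows "viscosity_subsolution c h (\<lambda>t. w t - \<delta> + \<epsilon> * t)"
  unfolding viscosity_subsolution_def
proof (intro conjI ballI allI impI)
  show "continuous_on {0..1} (\<lambda>t. w t - \<delta> + \<epsilon> * t)"
    using sub unfolding viscosity_subsolution_def by (auto intro!: continuous_intros)
next
  fix s :: real and \<phi> \<phi>' :: "real \<Rightarrow> real"
  assume s: "s \<in> {0<..<1}"
    and der: "\<forall>t\<in>{0<..<1}. (\<phi> has_real_derivative \<phi>' t) (at t)"
    and c1: "continuous_on {0<..<1} \<phi>'"
    and ev: "\<forall>\<^sub>F t in nhds s. w t - \<delta> + \<epsilon> * t - \<phi> t \<le> w s - \<delta> + \<epsilon> * s - \<phi> s"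
  have der': "\<forall>t\<in>{0<..<1}. ((\<lambda>t. \<phi> t - \<epsilon> * t) has_real_derivative (\<phi>' t - \<epsilon>)) (at t)"
    using der by (auto intro!: derivative_eq_intros)
  have c1': "continuous_on {0<..<1} (\<lambda>t. \<phi>' t - \<epsilon>)"
    using c1 by (intro continuous_intros)
  have ev': "\<forall>\<^sub>F t in nhds s. w t - (\<phi> t - \<epsilon> * t) \<le> w s - (\<phi> s - \<epsilon> * s)"
    using ev by eventually_elim simp
  have test: "c * w s + h s (\<phi>' s - \<epsilon>) \<le> 0"
    by (rule viscosity_subsolution_test[OF sub s der' c1' ev'])
  have "c * (- K) \<le> c * w s" using low s \<open>c > 0\<close> by (intro mult_left_mono) auto
  with test have "h s (\<phi>' s - \<epsilon>) \<le> c * K" by simp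
  then have "h s (\<phi>' s) \<le> h s (\<phi>' s - \<epsilon>) + c * \<delta> / 2"
    using shift[rule_format, of s "\<phi>' s - \<epsilon>"] s by simp
  moreover have "\<epsilon> * s \<le> \<delta> / 2"
    using eps s mult_left_le[of s \<epsilon>] by auto
  then have "c * (\<epsilon> * s) \<le> c * (\<delta> / 2)" using \<open>c > 0\<close> by auto
  ultimately show "c * (w s - \<delta> + \<epsilon> * s) + h s (\<phi>' s) \<le> 0"
    using test by (simp add: algebra_simps)
qed

section \<open>The maximal subsolution at the terminal point\<close>

lemma max_subsolution_strict:
  fixes h :: "real \<Rightarrow> real \<Rightarrow> real"
  assumes cont: "continuous_on ({0..1} \<times> UNIV) (\<lambda>(s, p). h s p)"
    and coer: "\<forall>M. \<exists>R. \<forall>s\<in>{0..1}. \<forall>p. \<bar>p\<bar> \<ge> R \<longrightarrow> h s p \<ge> M"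
    and "c > 0" "\<delta> > 0" "\<alpha> \<le> \<beta> + \<delta>"
  shows "max_subsolution c h \<alpha> 1 < max_subsolution c h \<beta> 1 + \<delta>"
proof -
  obtain m where m: "\<forall>s\<in>{0..1}. \<forall>p. m \<le> h s p"
    using coercive_bounded_below[OF cont coer] by blast
  have "compact ((\<lambda>(s, p). h s p) ` ({0..1} \<times> {0}))"
    by (intro compact_continuous_image continuous_on_subset[OF cont] compact_Times) auto
  then have "bdd_above ((\<lambda>(s, p). h s p) ` ({0..1} \<times> {0}))"
    by (intro bounded_imp_bdd_above compact_imp_bounded)
  then obtain B where B: "\<And>s. s \<in> {0..1} \<Longrightarrow> h s 0 \<le> B"
    unfolding bdd_above_def by force
  \<comment> \<open>The constant \<open>- K\<close> is a subsolution that competes in the supremum for \<open>\<alpha>\<close>.\<close>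
  define K where "K = max (B / c) (- \<alpha>)"
  have K: "\<forall>s\<in>{0..1}. h s 0 \<le> c * K"
  proof
    fix s :: real assume "s \<in> {0..1}"
    then have "h s 0 \<le> c * (B / c)" using B \<open>c > 0\<close> by simp
    also have "\<dots> \<le> c * K" using \<open>c > 0\<close> by (intro mult_left_mono) (auto simp: K_def)
    finally show "h s 0 \<le> c * K" .
  qed
  have Ka: "- K \<le> \<alpha>" by (auto simp: K_def)
  have "c * \<delta> / 2 > 0" using \<open>c > 0\<close> \<open>\<delta> > 0\<close> by simp
  from coercive_slope_shift[OF cont coer this, of "c * K"] obtain d where d: "d > 0"
    and shift: "\<forall>\<epsilon>\<in>{0..<d}. \<forall>s\<in>{0..1}. \<forall>p. h s p \<le> c * K \<longrightarrow> h s (p + \<epsilon>) \<le> h s p + c * \<delta> / 2"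
    by blast
  define \<epsilon> where "\<epsilon> = min (d / 2) (\<delta> / 2)"
  have \<epsilon>: "0 < \<epsilon>" "\<epsilon> \<in> {0..<d}" "\<epsilon> \<le> \<delta> / 2" using d \<open>\<delta> > 0\<close> by (auto simp: \<epsilon>_def)
  let ?S = "\<lambda>\<alpha>. {w 1 | w. viscosity_subsolution c h w \<and> w 0 \<le> \<alpha>}"
  have bdd: "bdd_above (?S \<beta>)"
    using viscosity_subsolution_bound[OF _ \<open>c > 0\<close> m] unfolding bdd_above_def by blast
  have "Sup (?S \<alpha>) \<le> Sup (?S \<beta>) + \<delta> - \<epsilon>"
  proof (rule cSup_least)
    show "?S \<alpha> \<noteq> {}" using viscosity_subsolution_const[of h c K, OF K] Ka by blast
  next
    fix y assume "y \<in> ?S \<alpha>"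
    then obtain w where w: "viscosity_subsolution c h w" "w 0 \<le> \<alpha>" "y = w 1" by blast
    let ?v = "\<lambda>t. max (w t) (- K)"
    have "viscosity_subsolution c h (\<lambda>t. ?v t - \<delta> + \<epsilon> * t)"
      using viscosity_subsolution_tilt[of c h ?v K \<epsilon> \<delta>,
          OF viscosity_subsolution_max_const[of c h w K, OF w(1) K] \<open>c > 0\<close>] shift \<epsilon> by auto
    moreover have "?v 0 - \<delta> + \<epsilon> * 0 \<le> \<beta>" using w(2) Ka \<open>\<alpha> \<le> \<beta> + \<delta>\<close> by auto
    ultimately have "?v 1 - \<delta> + \<epsilon> * 1 \<in> ?S \<beta>"
      by (intro CollectI exI[of _ "\<lambda>t. ?v t - \<delta> + \<epsilon> * t"]) auto
    then have "?v 1 - \<delta> + \<epsilon> * 1 \<le> Sup (?S \<beta>)" using bdd by (rule cSup_upper)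
    then show "y \<le> Sup (?S \<beta>) + \<delta> - \<epsilon>" using w(3) by auto
  qed
  then show ?thesis using \<epsilon>(1) unfolding max_subsolution_def by auto
qed

section \<open>Comparison on the graph\<close>

lemma edge_term_eq_pathfinish:
  assumes "network \<A>" "bij_betw \<Psi> Es \<A>" "e \<in> Es"
  shows "edge_term Es \<Psi> e = pathfinish (\<Psi> e)"
proof -
  have img: "\<Psi> ` Es = \<A>" using assms(2) by (rule bij_betw_imp_surj_on)
  have "\<forall>\<gamma>\<in>\<A>. reversepath \<gamma> \<in> \<A>" using assms(1) unfolding network_def by (elim conjE)
  then have "reversepath (\<Psi> e) \<in> \<Psi> ` Es" using img assms(3) by blast
  then show ?thesis
    unfolding edge_term_def edge_orig_def edge_rev_def by (simp add: f_inv_into_f)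
qed

lemma incoming_edge_exists:
  assumes net: "network \<A>" and bij: "bij_betw \<Psi> Es \<A>" and x: "x \<in> vertices \<A>"
  shows "\<exists>e\<in>Es. edge_term Es \<Psi> e = x"
proof -
  have img: "\<Psi> ` Es = \<A>" using bij by (rule bij_betw_imp_surj_on)
  have rev: "\<forall>\<gamma>\<in>\<A>. reversepath \<gamma> \<in> \<A>" using net unfolding network_def by (elim conjE)
  obtain \<gamma> where \<gamma>: "\<gamma> \<in> \<A>" "x = pathfinish \<gamma>"
  proof -
    consider \<gamma> where "\<gamma> \<in> \<A>" "x = pathstart \<gamma>" | \<gamma> where "\<gamma> \<in> \<A>" "x = pathfinish \<gamma>"
      using x unfolding vertices_def by blast
    then show ?thesis
    proof cases
      case (1 \<gamma>)
      then show ?thesis using rev that[of "reversepath \<gamma>"] by simp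
    qed (rule that)
  qed
  then obtain e where "e \<in> Es" "\<Psi> e = \<gamma>" using img by blast
  then show ?thesis using edge_term_eq_pathfinish[OF net bij] \<gamma>(2) by blast
qed

theorem theorem4p4:
  fixes \<A> :: "(real \<Rightarrow> real ^ 'n) set"
    and H :: "(real \<Rightarrow> real ^ 'n) \<Rightarrow> real \<Rightarrow> real \<Rightarrow> real"
    and Es :: "'e set"
    and \<Psi> :: "'e \<Rightarrow> real \<Rightarrow> real ^ 'n"
    and c :: real
    and U W :: "real ^ 'n \<Rightarrow> real"
  assumes "network \<A>"
    and "hamiltonians \<A> H"
    and "bij_betw \<Psi> Es \<A>"
    and "c > 0"
    and "\<forall>x\<in>vertices \<A>. U x \<le> discrete_rhs c H Es \<Psi> U x"
    and "\<forall>x\<in>vertices \<A>. W x \<ge> discrete_rhs c H Es \<Psi> W x"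
  shows "\<forall>x\<in>vertices \<A>. U x \<le> W x"
proof (rule ccontr)
  assume "\<not> (\<forall>x\<in>vertices \<A>. U x \<le> W x)"
  then obtain y where y: "y \<in> vertices \<A>" "U y > W y" by auto
  have finA: "finite \<A>" using assms(1) unfolding network_def by (elim conjE)
  then have finV: "finite (vertices \<A>)" unfolding vertices_def by auto
  have finE: "finite Es" using finA assms(3) bij_betw_finite by blast
  obtain x where x: "x \<in> vertices \<A>"
    and xmax: "\<And>z. z \<in> vertices \<A> \<Longrightarrow> U z - W z \<le> U x - W x"
  proof -
    have "vertices \<A> \<noteq> {}" using y by blast
    then have "Max ((\<lambda>z. U z - W z) ` vertices \<A>) \<in> (\<lambda>z. U z - W z) ` vertices \<A>"
      using finV by (intro Max_in) auto
    then obtain x where "x \<in> vertices \<A>" "Max ((\<lambda>z. U z - W z) ` vertices \<A>) = U x - W x"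
      by blast
    moreover have "U z - W z \<le> Max ((\<lambda>z. U z - W z) ` vertices \<A>)" if "z \<in> vertices \<A>" for z
      using finV that by (intro Max_ge) auto
    ultimately show ?thesis using that by metis
  qed
  define \<delta> where "\<delta> = U x - W x"
  have \<delta>: "\<delta> > 0" using xmax[OF y(1)] y(2) by (auto simp: \<delta>_def)
  let ?S = "\<lambda>F. {edge_rho c H \<Psi> (F (edge_orig \<Psi> e)) e | e. e \<in> Es \<and> edge_term Es \<Psi> e = x}"
  have fin: "finite (?S F)" for F :: "real ^ 'n \<Rightarrow> real"
    using finE by auto
  have "?S W \<noteq> {}" using incoming_edge_exists[OF assms(1,3) x] by blast
  then have "Min (?S W) \<in> ?S W" using fin by (intro Min_in)
  then obtain e where e: "e \<in> Es" "edge_term Es \<Psi> e = x"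
    and eW: "Min (?S W) = edge_rho c H \<Psi> (W (edge_orig \<Psi> e)) e" by auto
  have W: "edge_rho c H \<Psi> (W (edge_orig \<Psi> e)) e \<le> W x"
    using assms(6)[rule_format, OF x] eW unfolding discrete_rhs_def by simp
  have "Min (?S U) \<le> edge_rho c H \<Psi> (U (edge_orig \<Psi> e)) e"
    using fin e by (intro Min_le) auto
  then have U: "U x \<le> edge_rho c H \<Psi> (U (edge_orig \<Psi> e)) e"
    using assms(5)[rule_format, OF x] unfolding discrete_rhs_def by linarith
  have arc: "\<Psi> e \<in> \<A>" using e(1) assms(3) unfolding bij_betw_def by auto
  have "edge_orig \<Psi> e \<in> vertices \<A>"
    using arc unfolding edge_orig_def vertices_def by auto
  then have "U (edge_orig \<Psi> e) \<le> W (edge_orig \<Psi> e) + \<delta>"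
    using xmax[of "edge_orig \<Psi> e"] unfolding \<delta>_def by simp
  moreover have "continuous_on ({0..1} \<times> UNIV) (\<lambda>(s, p). H (\<Psi> e) s p)"
    and "\<forall>M. \<exists>R. \<forall>s\<in>{0..1}. \<forall>p. \<bar>p\<bar> \<ge> R \<longrightarrow> H (\<Psi> e) s p \<ge> M"
    using assms(2)[unfolded hamiltonians_def, THEN bspec, OF arc] by blast+
  ultimately have "edge_rho c H \<Psi> (U (edge_orig \<Psi> e)) e < edge_rho c H \<Psi> (W (edge_orig \<Psi> e)) e + \<delta>"
    unfolding edge_rho_def using assms(4) \<delta> max_subsolution_strict[of "H (\<Psi> e)" c \<delta>] by blast
  then show False using U W unfolding \<delta>_def by simp
qed

end
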